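(* Let $\alpha=(\alpha_1,\dots,\alpha_m)$ be a generic length vector with $\alpha_1\le\dots\le\alpha_{m-1}$, $\alpha_m<\sum_{i<m}\alpha_i$, and $\alpha_i<\sum_{j\ne i}\alpha_j$ for every $i\in[m]$. Then the moment polytope $\mathrm{P}(\alpha)$ is a flagtope if and only if the short code of $\alpha$ is one of: (1) $<\{1,2,\dots,m-3,m\}>$; (2) $<\{1,2,\dots,m-4,m-2,m\}>$; (3) $<\{1,2,\dots,m-4,m-1,m\}>$.
   Context: A length vector is a tuple of positive reals; generic means $\sum_i\varepsilon_i\alpha_i\ne0$ for all signs $\varepsilon_i\in\{\pm1\}$. $I\subseteq[m]$ is $\alpha$-short if $\sum_{i\in I}\alpha_i<\sum_{j\notin I}\alpha_j$. Short code: $S_m(\alpha)=\{J\subseteq[m]:m\in J,\ J\ \alpha\text{-short}\}$, ordered by $I\le J$ iff, writing $I=\{i_1<\dots<i_t\}$, there exist distinct $j_1,\dots,j_t\in J$ with $i_s\le j_s$; the short code $<A_1,\dots,A_k>$ lists the maximal elements. Moment polytope: $\mathrm{P}(\alpha)=\prod_{i=1}^{m-1}[-\alpha_i,\alpha_i]\cap\{w\in\mathbb{R}^{m-1}:\sum_{i=1}^{m-1}w_i=\alpha_m\}$. A simple $n$-polytope is a flagtope if every collection of pairwise intersecting facets has nonempty intersection. *)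

theory Defs
  imports "HOL-Analysis.Analysis"
begin

text \<open>A tuple \<open>(\<alpha>\<^sub>1, \<dots>, \<alpha>\<^sub>m)\<close> is a function \<open>\<alpha> :: nat \<Rightarrow> real\<close> of which only the values on
  \<open>{1..m}\<close> matter.\<close>

definition length_vector :: "nat \<Rightarrow> (nat \<Rightarrow> real) \<Rightarrow> bool" where
  "length_vector m \<alpha> \<longleftrightarrow> (\<forall>i\<in>{1..m}. 0 < \<alpha> i)"

definition generic :: "nat \<Rightarrow> (nat \<Rightarrow> real) \<Rightarrow> bool" where
  "generic m \<alpha> \<longleftrightarrow>
     (\<forall>\<epsilon> :: nat \<Rightarrow> real. (\<forall>i\<in>{1..m}. \<epsilon> i \<in> {-1, 1}) \<longrightarrow> (\<Sum>i=1..m. \<epsilon> i * \<alpha> i) \<noteq> 0)"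

definition short :: "nat \<Rightarrow> (nat \<Rightarrow> real) \<Rightarrow> nat set \<Rightarrow> bool" where
  "short m \<alpha> I \<longleftrightarrow> I \<subseteq> {1..m} \<and> (\<Sum>i\<in>I. \<alpha> i) < (\<Sum>j\<in>{1..m} - I. \<alpha> j)"

definition short_family :: "nat \<Rightarrow> (nat \<Rightarrow> real) \<Rightarrow> nat set set" where
  "short_family m \<alpha> = {J. J \<subseteq> {1..m} \<and> m \<in> J \<and> short m \<alpha> J}"

text \<open>The injection \<open>f\<close> sends \<open>i\<^sub>s\<close> to \<open>j\<^sub>s\<close>.\<close>

definition code_le :: "nat set \<Rightarrow> nat set \<Rightarrow> bool" where
  "code_le I J \<longleftrightarrow> (\<exists>f. inj_on f I \<and> f ` I \<subseteq> J \<and> (\<forall>i\<in>I. i \<le> f i))"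

text \<open>The code \<open><A\<^sub>1, \<dots>, A\<^sub>k>\<close> is the set \<open>{A\<^sub>1, \<dots>, A\<^sub>k}\<close>.\<close>

definition short_code :: "nat \<Rightarrow> (nat \<Rightarrow> real) \<Rightarrow> nat set set" where
  "short_code m \<alpha> =
     {A \<in> short_family m \<alpha>. \<forall>B\<in>short_family m \<alpha>. code_le A B \<longrightarrow> B = A}"

text \<open>The space \<open>\<real>\<^bsup>m-1\<^esup>\<close> is rendered as \<^typ>\<open>real ^ 'n\<close>, where \<open>e\<close> is a bijection from the index
  type \<open>'n\<close> onto \<open>{1..m-1}\<close> giving the number of each coordinate: the coordinate \<open>w $ i\<close>
  is the paper's \<open>w\<^sub>k\<close> for \<open>k = e i\<close>.\<close>

definition moment_polytope ::
    "('n::finite \<Rightarrow> nat) \<Rightarrow> nat \<Rightarrow> (nat \<Rightarrow> real) \<Rightarrow> (real ^ 'n) set" where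
  "moment_polytope e m \<alpha> =
     cbox (\<chi> i. - \<alpha> (e i)) (\<chi> i. \<alpha> (e i)) \<inter> {w. (\<Sum>i\<in>UNIV. w $ i) = \<alpha> m}"

text \<open>An \<open>n\<close>-polytope is simple if each of its vertices lies on exactly \<open>n\<close> facets.\<close>

definition simple_polytope :: "'a::euclidean_space set \<Rightarrow> bool" where
  "simple_polytope P \<longleftrightarrow> polytope P \<and>
     (\<forall>v. v extreme_point_of P \<longrightarrow> int (card {F. F facet_of P \<and> v \<in> F}) = aff_dim P)"

text \<open>For the empty collection \<open>\<C>\<close> the condition is vacuous, as \<open>\<Inter>{} = UNIV\<close>.\<close>

definition flagtope :: "'a::euclidean_space set \<Rightarrow> bool" where
  "flagtope P \<longleftrightarrow> simple_polytope P \<and>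
     (\<forall>\<C>. \<C> \<subseteq> {F. F facet_of P} \<and> (\<forall>F\<in>\<C>. \<forall>G\<in>\<C>. F \<inter> G \<noteq> {}) \<longrightarrow> \<Inter>\<C> \<noteq> {})"

end

theory Submission
  imports Defs
begin

text \<open>A point of the polytope with coordinates \<open>\<alpha>\<^sub>i\<close> for \<open>i \<in> A\<close> and \<open>-\<alpha>\<^sub>i\<close> for \<open>i \<in> B\<close> exists iff
  \<open>A\<close> and \<open>B\<close> are disjoint and both \<open>A\<close> and \<open>B \<union> {m}\<close> are short. Hence the polytope is a flagtope iff
  the short subsets of \<open>[m-1]\<close> and the sets \<open>B \<subseteq> [m-1]\<close> with \<open>B \<union> {m}\<close> short are both determined by
  their pairs. The first condition says that a subset of \<open>[m-1]\<close> is long iff it contains an edge of the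
  graph of long pairs; by complementation \<open>B \<union> {m}\<close> is long iff \<open>B\<close> is a vertex cover of this graph, and
  the second condition says that the minimal vertex covers have at most two elements. Long sets
  intersect, so the graph is a star or a triangle; the bound on covers leaves stars with one or two edges
  and the triangle, and these are the three codes since long pairs are closed under shifting upwards.\<close>

subsection \<open>The order on codes\<close>

lemma code_le_refl: "code_le A A"
  unfolding code_le_def by (intro exI[of _ id] conjI) simp_all

lemma code_le_trans:
  assumes "code_le A B" "code_le B C"
  shows "code_le A C"
proof -
  obtain f g where f: "inj_on f A" "f ` A \<subseteq> B" "\<forall>i\<in>A. i \<le> f i"
    and g: "inj_on g B" "g ` B \<subseteq> C" "\<forall>i\<in>B. i \<le> g i"
    using assms unfolding code_le_def by blast
  have "inj_on (g \<circ> f) A"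
    using f g by (meson comp_inj_on inj_on_subset)
  moreover have "(g \<circ> f) ` A \<subseteq> C" using f(2) g(2) by auto
  moreover have "\<forall>i\<in>A. i \<le> (g \<circ> f) i"
  proof
    fix i assume i: "i \<in> A"
    then have "f i \<in> B" using f(2) by blast
    then show "i \<le> (g \<circ> f) i" using f(3) g(3) i order_trans by fastforce
  qed
  ultimately show ?thesis unfolding code_le_def by blast
qed

text \<open>Summing \<open>Suc i\<close> rather than \<open>i\<close> lets the weight detect the element \<open>0\<close>.\<close>

lemma code_le_weight:
  assumes "code_le A B" "finite B"
  shows "sum Suc A \<le> sum Suc B" and "sum Suc B \<le> sum Suc A \<Longrightarrow> A = B"
proof -
  obtain f where f: "inj_on f A" "f ` A \<subseteq> B" "\<forall>i\<in>A. i \<le> f i"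
    using assms(1) unfolding code_le_def by blast
  have finA: "finite A" using f assms(2) by (metis finite_subset finite_imageD)
  have 1: "sum Suc A \<le> sum (\<lambda>i. Suc (f i)) A" using f by (intro sum_mono) auto
  have 2: "sum (\<lambda>i. Suc (f i)) A = sum Suc (f ` A)" using f(1) by (simp add: sum.reindex)
  have 3: "sum Suc B = sum Suc (f ` A) + sum Suc (B - f ` A)"
    using sum.subset_diff[OF f(2) assms(2), of Suc] by simp
  show "sum Suc A \<le> sum Suc B" using 1 2 3 by simp
  assume "sum Suc B \<le> sum Suc A"
  then have eq: "sum (\<lambda>i. Suc (f i)) A = sum Suc A" and "sum Suc (B - f ` A) = 0"
    using 1 2 3 by auto
  then have "f ` A = B" using f(2) assms(2) by auto
  moreover have "f i = i" if "i \<in> A" for i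
  proof (rule ccontr)
    assume "f i \<noteq> i"
    then have "sum Suc A < sum (\<lambda>i. Suc (f i)) A"
      using f(3) that finA by (intro sum_strict_mono_ex1) (auto simp: less_Suc_eq_le order_less_le intro!: bexI[of _ i])
    then show False using eq by simp
  qed
  ultimately show "A = B" by force
qed

subsection \<open>Short sets and the graph of long pairs\<close>

text \<open>A pair missing two of \<open>p\<close>, \<open>q\<close>, \<open>r\<close> would be
  disjoint from the edge joining these two, so it contains two of the three vertices. The orderings
  decide which entry is which.\<close>

lemma pair_meets_triangle:
  fixes x y p q r :: nat
  assumes "{x, y} \<inter> {q, r} \<noteq> {}" "{x, y} \<inter> {p, r} \<noteq> {}" "{x, y} \<inter> {p, q} \<noteq> {}"
    and "x < y" "p < q" "q < r"
  shows "x = q \<and> y = r \<or> x = p \<and> y = r \<or> x = p \<and> y = q"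
proof -
  have "x = q \<or> x = r \<or> y = q \<or> y = r" "x = p \<or> x = r \<or> y = p \<or> y = r"
    "x = p \<or> x = q \<or> y = p \<or> y = q"
    using assms(1-3) by blast+
  then show ?thesis using assms(4-6) by linarith
qed

locale side_lengths =
  fixes m :: nat and \<alpha> :: "nat \<Rightarrow> real"
  assumes pos: "i \<in> {1..m} \<Longrightarrow> 0 < \<alpha> i"
    and generic: "generic m \<alpha>"
    and mono: "mono_on {1..m - 1} \<alpha>"
    and single_less: "i \<in> {1..m} \<Longrightarrow> \<alpha> i < (\<Sum>j\<in>{1..m} - {i}. \<alpha> j)"
    and m_ge_3: "m \<ge> 3"
begin

lemma short_imp_subset: "short m \<alpha> A \<Longrightarrow> A \<subseteq> {1..m}"
  by (simp add: short_def)

lemma short_iff_half: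
  assumes "A \<subseteq> {1..m}"
  shows "short m \<alpha> A \<longleftrightarrow> 2 * sum \<alpha> A < sum \<alpha> {1..m}"
proof -
  have "sum \<alpha> {1..m} = sum \<alpha> ({1..m} - A) + sum \<alpha> A"
    by (rule sum.subset_diff[OF assms]) simp
  then show ?thesis using assms unfolding short_def by linarith
qed

text \<open>A set carrying exactly half of the total would give a vanishing signed sum, with sign +1
  on the set and -1 off it. Hence exactly one of a set and its complement is short, as
  \<open>short_Diff_iff\<close> records.\<close>

lemma sum_ne_half: "A \<subseteq> {1..m} \<Longrightarrow> 2 * sum \<alpha> A \<noteq> sum \<alpha> {1..m}"
proof
  assume A: "A \<subseteq> {1..m}" and half: "2 * sum \<alpha> A = sum \<alpha> {1..m}"
  define \<epsilon> :: "nat \<Rightarrow> real" where "\<epsilon> = (\<lambda>i. if i \<in> A then 1 else -1)"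
  have "(\<Sum>i=1..m. \<epsilon> i * \<alpha> i) = (\<Sum>i\<in>{1..m} - A. \<epsilon> i * \<alpha> i) + (\<Sum>i\<in>A. \<epsilon> i * \<alpha> i)"
    using A by (intro sum.subset_diff) auto
  also have "(\<Sum>i\<in>{1..m} - A. \<epsilon> i * \<alpha> i) = - sum \<alpha> ({1..m} - A)"
    unfolding sum_negf[symmetric] by (rule sum.cong) (auto simp: \<epsilon>_def)
  also have "(\<Sum>i\<in>A. \<epsilon> i * \<alpha> i) = sum \<alpha> A"
    by (rule sum.cong) (auto simp: \<epsilon>_def)
  also have "sum \<alpha> ({1..m} - A) = sum \<alpha> {1..m} - sum \<alpha> A"
    using A by (simp add: sum_diff)
  finally have "(\<Sum>i=1..m. \<epsilon> i * \<alpha> i) = 0" using half by simp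
  moreover have "\<forall>i\<in>{1..m}. \<epsilon> i \<in> {-1, 1}" by (simp add: \<epsilon>_def)
  ultimately show False using generic unfolding generic_def by blast
qed

lemma short_Diff_iff:
  assumes A: "A \<subseteq> {1..m}"
  shows "short m \<alpha> ({1..m} - A) \<longleftrightarrow> \<not> short m \<alpha> A"
proof -
  have "sum \<alpha> {1..m} = sum \<alpha> ({1..m} - A) + sum \<alpha> A"
    by (rule sum.subset_diff[OF A]) simp
  then show ?thesis
    using sum_ne_half[OF A] unfolding short_iff_half[OF A] short_iff_half[OF Diff_subset] by linarith
qed

lemma short_mono:
  assumes "short m \<alpha> B" "A \<subseteq> B"
  shows "short m \<alpha> A"
proof -
  have B: "B \<subseteq> {1..m}" using assms short_imp_subset by blast
  then have "sum \<alpha> A \<le> sum \<alpha> B"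
    using assms(2)
  proof (intro sum_mono2)
    show "finite B" using B finite_subset by blast
    show "0 \<le> \<alpha> b" if "b \<in> B - A" for b using pos[of b] B that by auto
  qed
  then show ?thesis using assms B short_iff_half[of A] short_iff_half[of B] by auto
qed

lemma short_single: "i \<in> {1..m} \<Longrightarrow> short m \<alpha> {i}"
  using single_less[of i] by (simp add: short_def)

lemma long_Int_nonempty:
  assumes "\<not> short m \<alpha> A" "\<not> short m \<alpha> B" "A \<subseteq> {1..m}" "B \<subseteq> {1..m}"
  shows "A \<inter> B \<noteq> {}"
proof
  assume "A \<inter> B = {}"
  then have "B \<subseteq> {1..m} - A" using assms by blast
  then show False using assms short_Diff_iff short_mono by blast
qed

text \<open>Monotonicity is available on \<open>{1..m - 1}\<close> only, so \<open>m\<close> must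
  not be compared with other indices. If \<open>m \<in> B\<close>, then \<open>fixm\<close> puts
  \<open>m\<close> in \<open>A\<close>, the bound \<open>i \<le> f i\<close> forces
  \<open>f m = m\<close>, and injectivity lets no other index reach \<open>m\<close>. If
  \<open>m \<notin> B\<close>, nothing is sent to \<open>m\<close> at all.\<close>

lemma short_code_le:
  assumes B: "short m \<alpha> B" and le: "code_le A B" and A: "A \<subseteq> {1..m}"
    and fixm: "m \<in> B \<longrightarrow> m \<in> A"
  shows "short m \<alpha> A"
proof -
  obtain f where f: "inj_on f A" "f ` A \<subseteq> B" "\<forall>i\<in>A. i \<le> f i"
    using le unfolding code_le_def by blast
  have Bm: "B \<subseteq> {1..m}" using B short_imp_subset by blast
  have "\<alpha> i \<le> \<alpha> (f i)" if i: "i \<in> A" for i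
  proof (cases "f i = m")
    case True
    then have "m \<in> A" using fixm f i by auto
    then have "f m = m" using f Bm by (metis atLeastAtMost_iff image_subset_iff le_antisym subsetD)
    then have "i = m" using f(1) i True \<open>m \<in> A\<close> by (metis inj_onD)
    then show ?thesis using True by simp
  next
    case False
    have "f i \<in> {1..m}" using f i Bm by blast
    then have "f i \<in> {1..m - 1}" "i \<in> {1..m - 1}" using False f(3) i A by fastforce+
    then show ?thesis using mono f(3) i by (auto simp: mono_on_def)
  qed
  then have "sum \<alpha> A \<le> (\<Sum>i\<in>A. \<alpha> (f i))" by (rule sum_mono)
  also have "\<dots> = sum \<alpha> (f ` A)" using f(1) by (simp add: sum.reindex)
  finally have "sum \<alpha> A \<le> sum \<alpha> (f ` A)" .
  moreover have "short m \<alpha> (f ` A)" using B f(2) short_mono by blast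
  ultimately show ?thesis
    using A short_iff_half[of A] short_iff_half[of "f ` A"] short_imp_subset[of "f ` A"] by auto
qed

text \<open>Among the members of the family above \<open>B\<close>, one of largest weight
  \<open>sum Suc\<close> is maximal: anything above it is still above \<open>B\<close>, hence no
  heavier, and \<open>code_le_weight\<close> turns this into equality.\<close>

lemma short_code_dominates:
  assumes "B \<in> short_family m \<alpha>"
  obtains A where "A \<in> short_code m \<alpha>" "code_le B A"
proof -
  let ?S = "{C \<in> short_family m \<alpha>. code_le B C}"
  have "?S \<subseteq> Pow {1..m}" by (auto simp: short_family_def)
  then have fin: "finite ?S" by (rule finite_subset) simp
  moreover have "?S \<noteq> {}" using assms code_le_refl by blast
  ultimately have "Max (sum Suc ` ?S) \<in> sum Suc ` ?S" by (intro Max_in) auto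
  then obtain A where A: "A \<in> ?S" "Max (sum Suc ` ?S) = sum Suc A" by auto
  have "D = A" if D: "D \<in> short_family m \<alpha>" "code_le A D" for D
  proof -
    have "D \<in> ?S" using A D code_le_trans by blast
    then have "sum Suc D \<le> sum Suc A"
      unfolding A(2)[symmetric] using fin by (intro Max_ge) auto
    moreover have "finite D" using D by (auto simp: short_family_def intro: finite_subset)
    ultimately show ?thesis using code_le_weight(2)[OF D(2)] by simp
  qed
  then show thesis using that A by (auto simp: short_code_def)
qed

text \<open>Every member lies below a maximal one and shortness passes downwards, so a unique
  maximal element generates the whole family. Conversely a greatest member is the only maximal one,
  antisymmetry coming from the weights. This turns each of the three codes into a membership
  test.\<close>

lemma short_code_eq_singleton_iff:
  assumes A: "A \<subseteq> {1..m}" "m \<in> A"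
  shows "short_code m \<alpha> = {A} \<longleftrightarrow>
    (\<forall>B. B \<subseteq> {1..m} \<and> m \<in> B \<longrightarrow> (short m \<alpha> B \<longleftrightarrow> code_le B A))"
proof
  assume code: "short_code m \<alpha> = {A}"
  then have "short m \<alpha> A" by (auto simp: short_code_def short_family_def)
  then show "\<forall>B. B \<subseteq> {1..m} \<and> m \<in> B \<longrightarrow> (short m \<alpha> B \<longleftrightarrow> code_le B A)"
  proof (intro allI impI iffI; elim conjE)
    fix B assume B: "B \<subseteq> {1..m}" "m \<in> B"
    { assume "short m \<alpha> B"
      then have "B \<in> short_family m \<alpha>" using B by (simp add: short_family_def)
      then show "code_le B A" using short_code_dominates code by (metis singletonD) }
    { assume "code_le B A"
      then show "short m \<alpha> B" using short_code_le[OF \<open>short m \<alpha> A\<close>] B by blast }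
  qed
next
  assume R: "\<forall>B. B \<subseteq> {1..m} \<and> m \<in> B \<longrightarrow> (short m \<alpha> B \<longleftrightarrow> code_le B A)"
  then have AF: "A \<in> short_family m \<alpha>" using A code_le_refl by (auto simp: short_family_def)
  have le: "code_le B A" if "B \<in> short_family m \<alpha>" for B
    using R that by (auto simp: short_family_def)
  have fin: "finite B" if "B \<in> short_family m \<alpha>" for B
    using that by (auto simp: short_family_def intro: finite_subset)
  have "B = A" if "B \<in> short_family m \<alpha>" "code_le A B" for B
    using code_le_weight(2)[OF that(2) fin[OF that(1)]]
      code_le_weight(1)[OF le[OF that(1)] fin[OF AF]] by simp
  then show "short_code m \<alpha> = {A}"
    using AF le by (auto simp: short_code_def)
qed

section \<open>Explicit descriptions of the sets below the three codes\<close>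

lemma code_le_edge_code_iff:
  assumes "B \<subseteq> {1..m}" "m \<in> B"
  shows "code_le B ({1..m - 3} \<union> {m}) \<longleftrightarrow> m - 2 \<notin> B \<and> m - 1 \<notin> B"
proof
  assume "code_le B ({1..m - 3} \<union> {m})"
  then obtain f where f: "inj_on f B" "f ` B \<subseteq> {1..m - 3} \<union> {m}" "\<forall>i\<in>B. i \<le> f i"
    unfolding code_le_def by blast
  \<comment> \<open>No other element of the target is as large as \<open>m\<close>; by injectivity
    the remaining indices are then squeezed into \<open>{1..m - 3}\<close>.\<close>
  have "f m = m" using f assms(2) by fastforce
  then have "f i \<in> {1..m - 3}" if "i \<in> B" "i \<noteq> m" for i
    using f(2) inj_on_eq_iff[OF f(1) that(1) assms(2)] that by auto
  then have "i \<le> m - 3" if "i \<in> B" "i \<noteq> m" for i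
    using f(3) that by (meson atLeastAtMost_iff order_trans)
  from this[of "m - 2"] this[of "m - 1"] show "m - 2 \<notin> B \<and> m - 1 \<notin> B"
    using m_ge_3 by force
next
  assume B: "m - 2 \<notin> B \<and> m - 1 \<notin> B"
  have "B \<subseteq> {1..m - 3} \<union> {m}"
  proof
    fix i assume "i \<in> B"
    then have "i \<noteq> m - 2" "i \<noteq> m - 1" "1 \<le> i" "i \<le> m" using B assms(1) by auto
    then show "i \<in> {1..m - 3} \<union> {m}" using m_ge_3 by auto
  qed
  then show "code_le B ({1..m - 3} \<union> {m})"
    unfolding code_le_def by (intro exI[of _ id] conjI) simp_all
qed

text \<open>An index \<open>i \<ge> m - 3\<close> other than \<open>m\<close> can only go to
  \<open>m - 2\<close>, the rest of \<open>{1..m - 4}\<close> being too small. This excludes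
  \<open>m - 1\<close> and admits at most one of \<open>m - 3\<close>, \<open>m - 2\<close>. In
  graph terms, \<open>B - {m}\<close> does not cover the star with edges
  \<open>{m - 3, m - 1}\<close> and \<open>{m - 2, m - 1}\<close>.\<close>

lemma code_le_star_code_iff:
  assumes "B \<subseteq> {1..m}" "m \<in> B" "m \<ge> 4"
  shows "code_le B ({1..m - 4} \<union> {m - 2, m}) \<longleftrightarrow>
    m - 1 \<notin> B \<and> (m - 2 \<notin> B \<or> m - 3 \<notin> B)"
proof
  assume "code_le B ({1..m - 4} \<union> {m - 2, m})"
  then obtain f where f: "inj_on f B" "f ` B \<subseteq> {1..m - 4} \<union> {m - 2, m}" "\<forall>i\<in>B. i \<le> f i"
    unfolding code_le_def by blast
  have "f m = m" using f assms(2) by fastforce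
  then have fi: "f i \<in> {1..m - 4} \<union> {m - 2}" if "i \<in> B" "i \<noteq> m" for i
    using f(2) inj_on_eq_iff[OF f(1) that(1) assms(2)] that by auto
  then have fi2: "f i = m - 2" if "i \<in> B" "i \<noteq> m" "i \<ge> m - 3" for i
    using f(3) that assms(3) by fastforce
  have "m - 1 \<notin> B" using fi2[of "m - 1"] f(3) assms(3) by force
  moreover have "m - 2 \<notin> B \<or> m - 3 \<notin> B"
  proof (rule ccontr)
    assume *: "\<not> ?thesis"
    then have "f (m - 2) = f (m - 3)" using fi2[of "m - 2"] fi2[of "m - 3"] assms(3) by auto
    then show False using f(1) * assms(3) by (auto dest: inj_onD)
  qed
  ultimately show "m - 1 \<notin> B \<and> (m - 2 \<notin> B \<or> m - 3 \<notin> B)" by blast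
next
  assume B: "m - 1 \<notin> B \<and> (m - 2 \<notin> B \<or> m - 3 \<notin> B)"
  let ?f = "\<lambda>i. if i = m - 3 then m - 2 else i"
  have "inj_on ?f B" using B by (auto simp: inj_on_def)
  moreover have "?f i \<in> {1..m - 4} \<union> {m - 2, m}" if "i \<in> B" for i
  proof -
    have "i \<noteq> m - 1" "1 \<le> i" "i \<le> m" using B assms(1) that by auto
    then show ?thesis using assms(3) by auto
  qed
  moreover have "\<forall>i\<in>B. i \<le> ?f i" by auto
  ultimately show "code_le B ({1..m - 4} \<union> {m - 2, m})"
    unfolding code_le_def by blast
qed

text \<open>The three indices \<open>m - 3\<close>, \<open>m - 2\<close>, \<open>m - 1\<close> have
  only \<open>m - 1\<close> to go to, so at most one of them occurs: \<open>B - {m}\<close> is not a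
  vertex cover of the triangle on them.\<close>

lemma code_le_triangle_code_iff:
  assumes "B \<subseteq> {1..m}" "m \<in> B" "m \<ge> 4"
  shows "code_le B ({1..m - 4} \<union> {m - 1, m}) \<longleftrightarrow>
    (m - 1 \<notin> B \<or> m - 2 \<notin> B) \<and> (m - 1 \<notin> B \<or> m - 3 \<notin> B) \<and> (m - 2 \<notin> B \<or> m - 3 \<notin> B)"
    (is "_ \<longleftrightarrow> ?R")
proof
  assume "code_le B ({1..m - 4} \<union> {m - 1, m})"
  then obtain f where f: "inj_on f B" "f ` B \<subseteq> {1..m - 4} \<union> {m - 1, m}" "\<forall>i\<in>B. i \<le> f i"
    unfolding code_le_def by blast
  have "f m = m" using f assms(2) by fastforce
  then have fi: "f i \<in> {1..m - 4} \<union> {m - 1}" if "i \<in> B" "i \<noteq> m" for i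
    using f(2) inj_on_eq_iff[OF f(1) that(1) assms(2)] that by auto
  then have fi2: "f i = m - 1" if "i \<in> B" "i \<noteq> m" "i \<ge> m - 3" for i
    using f(3) that assms(3) by fastforce
  then have "i = j" if "i \<in> B" "j \<in> B" "i \<noteq> m" "i \<ge> m - 3" "j \<noteq> m" "j \<ge> m - 3" for i j
    using f(1) that by (metis inj_onD)
  from this[of "m - 1" "m - 2"] this[of "m - 1" "m - 3"] this[of "m - 2" "m - 3"]
  moreover have "m - 1 \<noteq> m - 2" "m - 1 \<noteq> m - 3" "m - 2 \<noteq> m - 3" "m - 1 \<noteq> m" "m - 2 \<noteq> m"
      "m - 3 \<noteq> m" "m - 3 \<le> m - 1" "m - 3 \<le> m - 2" "m - 3 \<le> m - 3"
    using assms(3) by linarith+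
  ultimately show ?R by meson
next
  assume B: ?R
  \<comment> \<open>This map merges three indices, but it is injective on \<open>B\<close>, which
    contains at most one of them.\<close>
  let ?f = "\<lambda>i. if i \<in> {m - 3, m - 2} then m - 1 else i"
  have "inj_on ?f B" using B by (auto simp: inj_on_def)
  moreover have "?f i \<in> {1..m - 4} \<union> {m - 1, m}" if "i \<in> B" for i
  proof -
    have "1 \<le> i" "i \<le> m" using assms(1) that by auto
    then show ?thesis using assms(3) by auto
  qed
  moreover have "\<forall>i\<in>B. i \<le> ?f i" by auto
  ultimately show "code_le B ({1..m - 4} \<union> {m - 1, m})"
    unfolding code_le_def by blast
qed

section \<open>Long pairs, the flag condition and the three codes\<close>

lemma pair_shift:
  assumes long: "\<not> short m \<alpha> {x, y}" and "1 \<le> x" "x < y" "x \<le> x'" "y \<le> y'" "x' < y'" "y' \<le> m - 1"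
  shows "\<not> short m \<alpha> {x', y'}"
proof
  assume *: "short m \<alpha> {x', y'}"
  have "code_le {x, y} {x', y'}"
    unfolding code_le_def using assms
    by (intro exI[of _ "\<lambda>i. if i = x then x' else y'"]) (auto simp: inj_on_def)
  \<comment> \<open>The bound \<open>y' \<le> m - 1\<close> keeps \<open>m\<close> out of the
    target, so the condition on \<open>m\<close> in \<open>short_code_le\<close> holds
    vacuously.\<close>
  moreover have "{x, y} \<subseteq> {1..m}" "m \<notin> {x', y'}" using assms by auto
  ultimately show False using short_code_le[OF *] long by blast
qed

text \<open>This is the combinatorial content of the flag property: the two clauses belong to the
  facets on which a coordinate attains its upper or its lower bound. The choice \<open>x = y\<close>
  matters in the second clause, where it demands that \<open>{m, x}\<close> be short, that is, that
  the facet exist.\<close>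

definition flag_condition :: bool where
  "flag_condition \<longleftrightarrow>
     (\<forall>A\<subseteq>{1..m - 1}. (\<forall>x\<in>A. \<forall>y\<in>A. short m \<alpha> {x, y}) \<longrightarrow> short m \<alpha> A) \<and>
     (\<forall>B\<subseteq>{1..m - 1}. (\<forall>x\<in>B. \<forall>y\<in>B. short m \<alpha> (insert m {x, y})) \<longrightarrow> short m \<alpha> (insert m B))"

lemma short_insert_m_iff:
  assumes "J \<subseteq> {1..m - 1}"
  shows "short m \<alpha> (insert m J) \<longleftrightarrow> \<not> short m \<alpha> ({1..m - 1} - J)"
proof -
  have "{1..m} - insert m J = {1..m - 1} - J" using m_ge_3 by auto
  moreover have "insert m J \<subseteq> {1..m}" using assms m_ge_3 by fastforce
  ultimately show ?thesis using short_Diff_iff by metis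
qed

lemma short_iff_insert_m:
  assumes "A \<subseteq> {1..m - 1}"
  shows "short m \<alpha> A \<longleftrightarrow> \<not> short m \<alpha> (insert m ({1..m - 1} - A))"
proof -
  have "{1..m - 1} - ({1..m - 1} - A) = A" using assms by blast
  then show ?thesis using short_insert_m_iff[OF Diff_subset] by simp
qed

text \<open>Each code determines which sets \<open>insert m J\<close> are short, and by
  complementation which \<open>A \<subseteq> {1..m - 1}\<close> are. In all three cases a violation
  of either description already shows on at most two elements, so testing pairs suffices.\<close>

lemma code_imp_flag_condition:
  assumes "short_code m \<alpha> = {{1..m - 3} \<union> {m}} \<or>
      short_code m \<alpha> = {{1..m - 4} \<union> {m - 2, m}} \<or>
      short_code m \<alpha> = {{1..m - 4} \<union> {m - 1, m}}"
  shows flag_condition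
proof -
  \<comment> \<open>With \<open>m = 3\<close> the set \<open>{1..m - 4}\<close> is empty, and the
    last two codes would name a pair \<open>{k, 3}\<close>. Its complement is a singleton, hence
    short, so the pair is long.\<close>
  have m4: "m \<ge> 4"
    if "short_code m \<alpha> = {{1..m - 4} \<union> {k, m}}" "k = m - 2 \<or> k = m - 1" for k
  proof (rule ccontr)
    assume "\<not> m \<ge> 4"
    then have m: "m = 3" using m_ge_3 by simp
    then have k: "k \<in> {1, 2}" using that by auto
    have "short m \<alpha> {k, m}"
      using that m by (auto simp: short_code_def short_family_def)
    then have "\<not> short m \<alpha> ({1..m} - {k, m})"
      using k m by (subst short_Diff_iff) auto
    moreover have "{1..m} - {k, m} = {3 - k}" "3 - k \<in> {1..m}" using k m by auto
    ultimately show False using short_single by metis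
  qed
  have m: "m - 1 \<noteq> m" "m - 2 \<noteq> m" "m - 3 \<noteq> m" using m_ge_3 by auto
  have sub: "insert m J \<subseteq> {1..m}" if "J \<subseteq> {1..m - 1}" for J
    using that m_ge_3 by fastforce
  have X: "m - 1 \<in> {1..m - 1}" "m - 2 \<in> {1..m - 1}" using m_ge_3 by auto
  have X3: "m - 3 \<in> {1..m - 1}" if "m \<ge> 4" using that by auto
  consider (1) "short_code m \<alpha> = {{1..m - 3} \<union> {m}}"
    | (2) "short_code m \<alpha> = {{1..m - 4} \<union> {m - 2, m}}" "m \<ge> 4"
    | (3) "short_code m \<alpha> = {{1..m - 4} \<union> {m - 1, m}}" "m \<ge> 4"
    using assms m4 by blast
  then show ?thesis
  proof cases
    case 1
    have J: "short m \<alpha> (insert m J) \<longleftrightarrow> m - 2 \<notin> J \<and> m - 1 \<notin> J" if "J \<subseteq> {1..m - 1}" for J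
    proof -
      have "{1..m - 3} \<union> {m} \<subseteq> {1..m}" "m \<in> {1..m - 3} \<union> {m}" using m_ge_3 by auto
      then have "short m \<alpha> (insert m J) \<longleftrightarrow> code_le (insert m J) ({1..m - 3} \<union> {m})"
        using 1 short_code_eq_singleton_iff sub[OF that] by blast
      then show ?thesis
        unfolding code_le_edge_code_iff[OF sub[OF that] insertI1] using m by blast
    qed
    have A: "short m \<alpha> A \<longleftrightarrow> \<not> (m - 2 \<in> A \<and> m - 1 \<in> A)" if "A \<subseteq> {1..m - 1}" for A
      unfolding short_iff_insert_m[OF that] J[OF Diff_subset] using X by blast
    show ?thesis unfolding flag_condition_def
    proof (intro conjI allI impI)
      fix A assume A': "A \<subseteq> {1..m - 1}" "\<forall>x\<in>A. \<forall>y\<in>A. short m \<alpha> {x, y}"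
      have "\<not> (m - 2 \<in> {x, y} \<and> m - 1 \<in> {x, y})" if "x \<in> A" "y \<in> A" for x y
      proof -
        have sub: "{x, y} \<subseteq> {1..m - 1}" and sh: "short m \<alpha> {x, y}"
          using A' that by auto
        show ?thesis using A[OF sub] sh by (rule iffD1)
      qed
      then show "short m \<alpha> A" unfolding A[OF A'(1)] by blast
    next
      fix B assume B: "B \<subseteq> {1..m - 1}" "\<forall>x\<in>B. \<forall>y\<in>B. short m \<alpha> (insert m {x, y})"
      \<comment> \<open>The minimal covers of a single edge are single vertices, so the diagonal
        pairs suffice here.\<close>
      have "m - 2 \<notin> {x, x} \<and> m - 1 \<notin> {x, x}" if "x \<in> B" for x
      proof -
        have sub: "{x, x} \<subseteq> {1..m - 1}" and sh: "short m \<alpha> (insert m {x, x})"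
          using B that by blast+
        show ?thesis using J[OF sub] sh by (rule iffD1)
      qed
      then show "short m \<alpha> (insert m B)" unfolding J[OF B(1)] by blast
    qed
  next
    case 2
    have J: "short m \<alpha> (insert m J) \<longleftrightarrow> m - 1 \<notin> J \<and> (m - 2 \<notin> J \<or> m - 3 \<notin> J)"
      if "J \<subseteq> {1..m - 1}" for J
    proof -
      have "{1..m - 4} \<union> {m - 2, m} \<subseteq> {1..m}" "m \<in> {1..m - 4} \<union> {m - 2, m}" using m_ge_3 by auto
      then have "short m \<alpha> (insert m J) \<longleftrightarrow> code_le (insert m J) ({1..m - 4} \<union> {m - 2, m})"
        using 2(1) short_code_eq_singleton_iff sub[OF that] by blast
      then show ?thesis
        unfolding code_le_star_code_iff[OF sub[OF that] insertI1 2(2)] using m by blast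
    qed
    have A: "short m \<alpha> A \<longleftrightarrow> \<not> (m - 1 \<in> A \<and> (m - 2 \<in> A \<or> m - 3 \<in> A))" if "A \<subseteq> {1..m - 1}" for A
      unfolding short_iff_insert_m[OF that] J[OF Diff_subset] using X X3[OF 2(2)] by blast
    show ?thesis unfolding flag_condition_def
    proof (intro conjI allI impI)
      fix A assume A': "A \<subseteq> {1..m - 1}" "\<forall>x\<in>A. \<forall>y\<in>A. short m \<alpha> {x, y}"
      have "\<not> (m - 1 \<in> {x, y} \<and> (m - 2 \<in> {x, y} \<or> m - 3 \<in> {x, y}))" if "x \<in> A" "y \<in> A" for x y
      proof -
        have sub: "{x, y} \<subseteq> {1..m - 1}" and sh: "short m \<alpha> {x, y}"
          using A' that by auto
        show ?thesis using A[OF sub] sh by (rule iffD1)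
      qed
      then show "short m \<alpha> A" unfolding A[OF A'(1)] by blast
    next
      fix B assume B: "B \<subseteq> {1..m - 1}" "\<forall>x\<in>B. \<forall>y\<in>B. short m \<alpha> (insert m {x, y})"
      have "m - 1 \<notin> {x, y} \<and> (m - 2 \<notin> {x, y} \<or> m - 3 \<notin> {x, y})" if "x \<in> B" "y \<in> B" for x y
      proof -
        have sub: "{x, y} \<subseteq> {1..m - 1}" and sh: "short m \<alpha> (insert m {x, y})"
          using B that by auto
        show ?thesis using J[OF sub] sh by (rule iffD1)
      qed
      then show "short m \<alpha> (insert m B)" unfolding J[OF B(1)] by blast
    qed
  next
    case 3
    have J: "short m \<alpha> (insert m J) \<longleftrightarrow>
       (m - 1 \<notin> J \<or> m - 2 \<notin> J) \<and> (m - 1 \<notin> J \<or> m - 3 \<notin> J) \<and> (m - 2 \<notin> J \<or> m - 3 \<notin> J)"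
      if "J \<subseteq> {1..m - 1}" for J
    proof -
      have "{1..m - 4} \<union> {m - 1, m} \<subseteq> {1..m}" "m \<in> {1..m - 4} \<union> {m - 1, m}" using m_ge_3 by auto
      then have "short m \<alpha> (insert m J) \<longleftrightarrow> code_le (insert m J) ({1..m - 4} \<union> {m - 1, m})"
        using 3(1) short_code_eq_singleton_iff sub[OF that] by blast
      then show ?thesis
        unfolding code_le_triangle_code_iff[OF sub[OF that] insertI1 3(2)] using m by blast
    qed
    have A: "short m \<alpha> A \<longleftrightarrow>
       (m - 1 \<notin> A \<or> m - 2 \<notin> A) \<and> (m - 1 \<notin> A \<or> m - 3 \<notin> A) \<and> (m - 2 \<notin> A \<or> m - 3 \<notin> A)"
      if "A \<subseteq> {1..m - 1}" for A
      unfolding short_iff_insert_m[OF that] J[OF Diff_subset] using X X3[OF 3(2)] by blast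
    show ?thesis unfolding flag_condition_def
    proof (intro conjI allI impI)
      fix A assume A': "A \<subseteq> {1..m - 1}" "\<forall>x\<in>A. \<forall>y\<in>A. short m \<alpha> {x, y}"
      have "(m - 1 \<notin> {x, y} \<or> m - 2 \<notin> {x, y}) \<and> (m - 1 \<notin> {x, y} \<or> m - 3 \<notin> {x, y}) \<and>
          (m - 2 \<notin> {x, y} \<or> m - 3 \<notin> {x, y})" if "x \<in> A" "y \<in> A" for x y
      proof -
        have sub: "{x, y} \<subseteq> {1..m - 1}" and sh: "short m \<alpha> {x, y}"
          using A' that by auto
        show ?thesis using A[OF sub] sh by (rule iffD1)
      qed
      then show "short m \<alpha> A" unfolding A[OF A'(1)] by blast
    next
      fix B assume B: "B \<subseteq> {1..m - 1}" "\<forall>x\<in>B. \<forall>y\<in>B. short m \<alpha> (insert m {x, y})"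
      have "(m - 1 \<notin> {x, y} \<or> m - 2 \<notin> {x, y}) \<and> (m - 1 \<notin> {x, y} \<or> m - 3 \<notin> {x, y}) \<and>
          (m - 2 \<notin> {x, y} \<or> m - 3 \<notin> {x, y})" if "x \<in> B" "y \<in> B" for x y
      proof -
        have sub: "{x, y} \<subseteq> {1..m - 1}" and sh: "short m \<alpha> (insert m {x, y})"
          using B that by auto
        show ?thesis using J[OF sub] sh by (rule iffD1)
      qed
      then show "short m \<alpha> (insert m B)" unfolding J[OF B(1)] by blast
    qed
  qed
qed

text \<open>Upward shifting makes \<open>{m - 2, m - 1}\<close> an edge as soon as there is any.
  Whether \<open>{m - 3, m - 1}\<close> and then \<open>{m - 3, m - 2}\<close> are edges too
  separates the single edge, the star and the triangle.\<close>

lemma flag_condition_imp_code: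
  assumes flag_condition
  shows "short_code m \<alpha> = {{1..m - 3} \<union> {m}} \<or>
      short_code m \<alpha> = {{1..m - 4} \<union> {m - 2, m}} \<or>
      short_code m \<alpha> = {{1..m - 4} \<union> {m - 1, m}}"
proof -
  let ?X = "{1..m - 1}"
  define L where "L x y \<longleftrightarrow> x \<in> ?X \<and> y \<in> ?X \<and> x < y \<and> \<not> short m \<alpha> {x, y}" for x y
  have long_iff: "\<not> short m \<alpha> A \<longleftrightarrow> (\<exists>x\<in>A. \<exists>y\<in>A. L x y)" if A: "A \<subseteq> ?X" for A
  proof
    assume "\<not> short m \<alpha> A"
    then obtain x y where xy: "x \<in> A" "y \<in> A" "\<not> short m \<alpha> {x, y}"
      using assms A unfolding flag_condition_def by blast
    have "x \<noteq> y" using xy short_single[of x] A by fastforce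
    show "\<exists>x\<in>A. \<exists>y\<in>A. L x y"
    proof (cases "x < y")
      case True
      then have "L x y" using xy A by (auto simp: L_def)
      then show ?thesis using xy by blast
    next
      case False
      then have "L y x" using xy A \<open>x \<noteq> y\<close> by (auto simp: L_def insert_commute)
      then show ?thesis using xy by blast
    qed
  next
    assume "\<exists>x\<in>A. \<exists>y\<in>A. L x y"
    then obtain x y where "x \<in> A" "y \<in> A" "\<not> short m \<alpha> {x, y}" by (auto simp: L_def)
    then show "\<not> short m \<alpha> A" using short_mono[of A "{x, y}"] by auto
  qed
  have short_iff: "short m \<alpha> (insert m J) \<longleftrightarrow> (\<exists>x\<in>?X - J. \<exists>y\<in>?X - J. L x y)"
    if "J \<subseteq> ?X" for J
    using short_insert_m_iff[OF that] long_iff[of "?X - J"] by blast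
  have Bform: "\<exists>J. B = insert m J \<and> J \<subseteq> ?X \<and> m \<notin> J" if "B \<subseteq> {1..m}" "m \<in> B" for B
    using that by (intro exI[of _ "B - {m}"]) force
  have shift: "L x' y'" if "L x y" "x \<le> x'" "y \<le> y'" "x' < y'" "y' \<le> m - 1" for x y x' y'
    using that pair_shift[of x y x' y'] by (auto simp: L_def)
  have meet: "{x, y} \<inter> {x', y'} \<noteq> {}" if "L x y" "L x' y'" for x y x' y'
    using that by (intro long_Int_nonempty) (auto simp: L_def)
  have X: "m - 1 \<in> ?X" "m - 2 \<in> ?X" using m_ge_3 by auto
  \<comment> \<open>Shortness of \<open>{m}\<close> makes its complement \<open>{1..m - 1}\<close>
    long, so the graph has an edge.\<close>
  have "short m \<alpha> (insert m {})"
    using short_single[of m] m_ge_3 by simp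
  then obtain x y where "L x y" using short_iff[of "{}"] by auto
  then have top: "L (m - 2) (m - 1)"
    by (rule shift) (use \<open>L x y\<close> m_ge_3 in \<open>auto simp: L_def\<close>)
  have max: "x \<le> m - 2 \<and> y \<le> m - 1 \<and> 1 \<le> x" if "L x y" for x y using that by (auto simp: L_def)
  have m: "m - 1 \<noteq> m" "m - 2 \<noteq> m" "m - 3 \<noteq> m" "m - 2 \<noteq> m - 1" using m_ge_3 by auto
  show ?thesis
  proof (cases "L (m - 3) (m - 1)")
    \<comment> \<open>An edge with \<open>x \<le> m - 3\<close> would shift up to
      \<open>{m - 3, m - 1}\<close>. For \<open>m = 3\<close> this case applies, since
      \<open>m - 3 = 0\<close> is no vertex.\<close>
    case False
    have L_eq: "L x y \<longleftrightarrow> x = m - 2 \<and> y = m - 1" for x y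
    proof
      assume xy: "L x y"
      have "\<not> x \<le> m - 3" using shift[OF xy, of "m - 3" "m - 1"] False max[OF xy] m_ge_3 by linarith
      then show "x = m - 2 \<and> y = m - 1" using max[OF xy] xy by (auto simp: L_def)
    qed (use top in simp)
    have "short_code m \<alpha> = {{1..m - 3} \<union> {m}}"
    proof (subst short_code_eq_singleton_iff; (intro allI impI)?)
      fix B assume B: "B \<subseteq> {1..m} \<and> m \<in> B"
      obtain J where J: "B = insert m J" "J \<subseteq> ?X" using Bform[of B] B by blast
      have "short m \<alpha> B \<longleftrightarrow> m - 2 \<in> ?X - J \<and> m - 1 \<in> ?X - J"
        unfolding J(1) short_iff[OF J(2)] Bex_def L_eq by blast
      also have "\<dots> \<longleftrightarrow> m - 2 \<notin> B \<and> m - 1 \<notin> B"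
        unfolding J(1) using m X by simp
      finally show "short m \<alpha> B \<longleftrightarrow> code_le B ({1..m - 3} \<union> {m})"
        using code_le_edge_code_iff B by blast
    qed (use m_ge_3 in auto)
    then show ?thesis by blast
  next
    case L31: True
    have m4: "m \<ge> 4" using max[OF L31] by arith
    have X3: "m - 3 \<in> ?X" using m4 by auto
    have m': "m - 3 \<noteq> m - 1" "m - 3 \<noteq> m - 2" using m4 by auto
    show ?thesis
    proof (cases "L (m - 3) (m - 2)")
      case False
      \<comment> \<open>An edge avoiding \<open>m - 1\<close> would shift up to
        \<open>{m - 3, m - 2}\<close>, which is no edge here; so all edges pass through
        \<open>m - 1\<close>.\<close>
      have last: "y = m - 1" if xy: "L x y" for x y
      proof (rule ccontr)
        assume "y \<noteq> m - 1"
        then have "x \<le> m - 3" "y \<le> m - 2" using max[OF xy] xy by (auto simp: L_def)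
        moreover have "m - 3 < m - 2" "m - 2 \<le> m - 1" using m4 by linarith+
        ultimately show False using shift[OF xy] False by blast
      qed
      txt \<open>The set \<open>B\<close> of leaves of the star is a vertex cover, so some pair of leaves is one; a pair of
        leaves covers the star only if there are no other leaves.\<close>
      define B where "B = {x. L x (m - 1)}"
      have BX: "B \<subseteq> ?X" "m - 1 \<notin> B" by (auto simp: B_def L_def)
      have "\<not> short m \<alpha> (insert m B)"
        unfolding short_iff[OF BX(1)] using last by (auto simp: B_def)
      then obtain p q where pq: "p \<in> B" "q \<in> B" "\<not> short m \<alpha> (insert m {p, q})"
        using assms BX(1) unfolding flag_condition_def by blast
      have pqX: "{p, q} \<subseteq> ?X" using pq BX by auto
      have B: "B \<subseteq> {p, q}"
      proof
        fix z assume "z \<in> B"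
        then have "L z (m - 1)" "z \<in> ?X" using BX by (auto simp: B_def)
        moreover have "m - 1 \<notin> {p, q}" using pq BX by auto
        ultimately show "z \<in> {p, q}" using pq(3) X(1) unfolding short_iff[OF pqX] by blast
      qed
      have "m - 2 \<in> B" "m - 3 \<in> B" using top L31 by (auto simp: B_def)
      then have "B = {m - 3, m - 2}" using B m' by blast
      then have L_eq: "L x y \<longleftrightarrow> y = m - 1 \<and> (x = m - 2 \<or> x = m - 3)" for x y
        using last[of x y] by (auto simp: B_def)
      have "short_code m \<alpha> = {{1..m - 4} \<union> {m - 2, m}}"
      proof (subst short_code_eq_singleton_iff; (intro allI impI)?)
        fix B assume B: "B \<subseteq> {1..m} \<and> m \<in> B"
        obtain J where J: "B = insert m J" "J \<subseteq> ?X" using Bform[of B] B by blast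
        have "short m \<alpha> B \<longleftrightarrow> m - 1 \<in> ?X - J \<and> (m - 2 \<in> ?X - J \<or> m - 3 \<in> ?X - J)"
          unfolding J(1) short_iff[OF J(2)] Bex_def L_eq by blast
        also have "\<dots> \<longleftrightarrow> m - 1 \<notin> B \<and> (m - 2 \<notin> B \<or> m - 3 \<notin> B)"
          unfolding J(1) using m X X3 by simp
        finally show "short m \<alpha> B \<longleftrightarrow> code_le B ({1..m - 4} \<union> {m - 2, m})"
          using code_le_star_code_iff B m4 by blast
      qed (use m_ge_3 in auto)
      then show ?thesis by blast
    next
      case L32: True
      have L_eq: "L x y \<longleftrightarrow> x = m - 2 \<and> y = m - 1 \<or> x = m - 3 \<and> y = m - 1 \<or> x = m - 3 \<and> y = m - 2"
        for x y
      proof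
        assume xy: "L x y"
        \<comment> \<open>Long sets intersect, so every edge meets all three sides of the
          triangle.\<close>
        have "{x, y} \<inter> {m - 2, m - 1} \<noteq> {}" "{x, y} \<inter> {m - 3, m - 1} \<noteq> {}"
          "{x, y} \<inter> {m - 3, m - 2} \<noteq> {}"
          using meet[OF xy] top L31 L32 by blast+
        moreover have "x < y" using xy by (simp add: L_def)
        moreover have "m - 3 < m - 2" "m - 2 < m - 1" using m4 by linarith+
        ultimately show "x = m - 2 \<and> y = m - 1 \<or> x = m - 3 \<and> y = m - 1 \<or> x = m - 3 \<and> y = m - 2"
          by (rule pair_meets_triangle)
      qed (use top L31 L32 in auto)
      have "short_code m \<alpha> = {{1..m - 4} \<union> {m - 1, m}}"
      proof (subst short_code_eq_singleton_iff; (intro allI impI)?)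
        fix B assume B: "B \<subseteq> {1..m} \<and> m \<in> B"
        obtain J where J: "B = insert m J" "J \<subseteq> ?X" using Bform[of B] B by blast
        have "short m \<alpha> B \<longleftrightarrow>
            (m - 1 \<in> ?X - J \<or> m - 2 \<in> ?X - J) \<and> (m - 1 \<in> ?X - J \<or> m - 3 \<in> ?X - J) \<and> (m - 2 \<in> ?X - J \<or> m - 3 \<in> ?X - J)"
          unfolding J(1) short_iff[OF J(2)] Bex_def L_eq by blast
        also have "\<dots> \<longleftrightarrow>
            (m - 1 \<notin> B \<or> m - 2 \<notin> B) \<and> (m - 1 \<notin> B \<or> m - 3 \<notin> B) \<and> (m - 2 \<notin> B \<or> m - 3 \<notin> B)"
          unfolding J(1) using m X X3 by simp
        finally show "short m \<alpha> B \<longleftrightarrow> code_le B ({1..m - 4} \<union> {m - 1, m})"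
          using code_le_triangle_code_iff B m4 by blast
      qed (use m_ge_3 in auto)
      then show ?thesis by blast
    qed
  qed
qed

end

subsection \<open>Faces of a hyperplane section of a box\<close>

text \<open>To be used with \<open>a i = \<alpha> (e i)\<close> and \<open>c = \<alpha> m\<close>.
  Up to a global change of sign, \<open>generic\<close> covers all sign vectors;
  \<open>c_less\<close> and \<open>a_less\<close> express that \<open>{m}\<close> and
  \<open>{e i}\<close> are short.\<close>

locale generic_slice =
  fixes a :: "'n::finite \<Rightarrow> real" and c :: real
  assumes a_pos: "0 < a i"
    and generic: "sum a A \<noteq> c + sum a (- A)"
    and c_pos: "0 < c"
    and c_less: "c < sum a UNIV"
    and a_less: "a i < c + sum a (- {i})"
begin

definition slice :: "(real ^ 'n) set" where
  "slice = cbox (\<chi> i. - a i) (\<chi> i. a i) \<inter> {w. (\<Sum>i\<in>UNIV. w $ i) = c}"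

definition face :: "'n set \<Rightarrow> 'n set \<Rightarrow> (real ^ 'n) set" where
  "face A B = {w \<in> slice. (\<forall>i\<in>A. w $ i = a i) \<and> (\<forall>i\<in>B. w $ i = - a i)}"

text \<open>When \<open>A\<close> sits at its upper bounds, the least possible coordinate sum is
  \<open>sum a A - sum a (- A)\<close>, and \<open>upper\<close> places \<open>c\<close> strictly
  above it. Dually, \<open>lower\<close> places \<open>c\<close> strictly below the greatest sum
  possible with \<open>B\<close> at its lower bounds.\<close>

definition upper :: "'n set \<Rightarrow> bool" where
  "upper A \<longleftrightarrow> sum a A < c + sum a (- A)"

definition lower :: "'n set \<Rightarrow> bool" where
  "lower B \<longleftrightarrow> c + sum a B < sum a (- B)"

lemma slice_iff: "w \<in> slice \<longleftrightarrow> (\<forall>i. \<bar>w $ i\<bar> \<le> a i) \<and> (\<Sum>i\<in>UNIV. w $ i) = c"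
  by (auto simp: slice_def mem_box_cart abs_le_iff) (smt (verit))+

lemma upper_empty: "upper {}"
  using c_pos a_pos by (simp add: upper_def add_pos_nonneg sum_nonneg less_imp_le)

lemma upper_single: "upper {i}"
  using a_less by (simp add: upper_def)

lemma lower_empty: "lower {}"
  using c_less by (simp add: lower_def Compl_eq_Diff_UNIV)

lemma sum_Compl: "sum f A + sum f (- A) = sum f UNIV" for f :: "'n \<Rightarrow> real"
  by (metis Compl_disjoint Compl_partition finite sum.union_disjoint)

text \<open>Bounding the free coordinates gives the weak inequalities; \<open>generic\<close> makes
  them strict.\<close>

lemma face_nonemptyD:
  assumes "w \<in> face A B"
  shows "A \<inter> B = {}" "upper A" "lower B"
proof -
  have w: "\<And>i. \<bar>w $ i\<bar> \<le> a i" "(\<Sum>i\<in>UNIV. w $ i) = c"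
    "\<And>i. i \<in> A \<Longrightarrow> w $ i = a i" "\<And>i. i \<in> B \<Longrightarrow> w $ i = - a i"
    using assms by (auto simp: face_def slice_iff)
  show "A \<inter> B = {}"
    using w(3,4) a_pos by (smt (verit) disjoint_iff)
  have split: "(\<Sum>i\<in>C. w $ i) + (\<Sum>i\<in>-C. w $ i) = c" for C
    using w(2) sum_Compl by metis
  have "(\<Sum>i\<in>A. w $ i) = sum a A"
    using w(3) by (simp cong: sum.cong)
  moreover have "- sum a (- A) \<le> (\<Sum>i\<in>-A. w $ i)"
    unfolding sum_negf[symmetric] by (rule sum_mono) (use w(1) in \<open>smt (verit)\<close>)
  ultimately show "upper A"
    using split[of A] generic[of A] unfolding upper_def by linarith
  have "(\<Sum>i\<in>B. w $ i) = - sum a B"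
    using w(4) by (simp add: sum_negf cong: sum.cong)
  moreover have "(\<Sum>i\<in>-B. w $ i) \<le> sum a (- B)"
    by (rule sum_mono) (use w(1) in \<open>smt (verit)\<close>)
  ultimately show "lower B"
    using split[of B] generic[of "- B"] unfolding lower_def by simp
qed

text \<open>All free coordinates take the same fraction \<open>l\<close> of their bounds, which the
  coordinate sum determines. Then \<open>\<bar>l\<bar> < 1\<close> amounts to \<open>upper A\<close>
  and \<open>lower B\<close> together.\<close>

lemma face_inner_point:
  assumes disj: "A \<inter> B = {}" and "upper A" "lower B"
  obtains w where "w \<in> face A B" "\<And>i. i \<notin> A \<union> B \<Longrightarrow> \<bar>w $ i\<bar> < a i"
proof -
  define R where "R = - (A \<union> B)"
  define r where "r = sum a R"
  define l where "l = (c - sum a A + sum a B) / r"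
  have AB: "A \<inter> R = {}" "B \<inter> R = {}" "- A = B \<union> R" "- B = A \<union> R"
    using disj by (auto simp: R_def)
  have sums: "sum a (- A) = sum a B + r" "sum a (- B) = sum a A + r"
    using AB by (simp_all add: r_def sum.union_disjoint)
  have abs: "\<bar>c - sum a A + sum a B\<bar> < r"
    using assms(2,3) sums by (auto simp: upper_def lower_def)
  \<comment> \<open>The strict bound rules out an empty \<open>R\<close>, so the division in
    \<open>l\<close> is legitimate.\<close>
  have r: "r > 0" using abs by linarith
  have l: "\<bar>l\<bar> < 1"
    using abs r by (simp add: l_def abs_divide)
  define w where "w = (\<chi> i. if i \<in> A then a i else if i \<in> B then - a i else l * a i)"
  have "(\<Sum>i\<in>UNIV. w $ i) = (\<Sum>i\<in>A. w $ i) + ((\<Sum>i\<in>B. w $ i) + (\<Sum>i\<in>R. w $ i))"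
    using sum_Compl[of "\<lambda>i. w $ i" A] AB by (simp add: sum.union_disjoint)
  also have "(\<Sum>i\<in>A. w $ i) = sum a A"
    by (rule sum.cong) (auto simp: w_def)
  also have "(\<Sum>i\<in>B. w $ i) = - sum a B"
    unfolding sum_negf[symmetric] by (rule sum.cong) (use disj in \<open>auto simp: w_def\<close>)
  also have "(\<Sum>i\<in>R. w $ i) = l * r"
    unfolding r_def sum_distrib_left by (rule sum.cong) (auto simp: w_def R_def)
  finally have sum_w: "(\<Sum>i\<in>UNIV. w $ i) = c"
    using r by (simp add: l_def)
  have strict: "\<bar>w $ i\<bar> < a i" if "i \<notin> A \<union> B" for i
    using that l a_pos[of i] by (simp add: w_def abs_mult)
  moreover have "w \<in> face A B"
  proof -
    have on_A: "w $ i = a i" if "i \<in> A" for i using that by (simp add: w_def)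
    have on_B: "w $ i = - a i" if "i \<in> B" for i using that disj by (auto simp: w_def)
    have "\<bar>w $ i\<bar> \<le> a i" for i
      using on_A[of i] on_B[of i] strict[of i] a_pos[of i] by fastforce
    then show ?thesis using on_A on_B sum_w by (simp add: face_def slice_iff)
  qed
  ultimately show thesis using that by blast
qed

lemma face_nonempty_iff: "face A B \<noteq> {} \<longleftrightarrow> A \<inter> B = {} \<and> upper A \<and> lower B"
  using face_nonemptyD face_inner_point by (metis all_not_in_conv)

text \<open>The sign \<open>s\<close>, always 1 or -1 in use, lets both bounds of a coordinate be
  treated at once.\<close>

definition side :: "'n \<Rightarrow> real \<Rightarrow> (real ^ 'n) set" where
  "side i s = {w \<in> slice. w $ i = s * a i}"

lemma face_single: "face {i} {} = side i 1" "face {} {i} = side i (-1)"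
  by (auto simp: face_def side_def)

lemma inner_point: obtains x where "x \<in> slice" "\<And>i. \<bar>x $ i\<bar> < a i"
  using face_inner_point[of "{}" "{}"] upper_empty lower_empty by (auto simp: face_def)

lemma side_inner_point:
  assumes "s \<in> {1, -1}" "side i s \<noteq> {}"
  obtains w where "w \<in> side i s" "\<And>j. j \<noteq> i \<Longrightarrow> \<bar>w $ j\<bar> < a j"
proof (cases "s = 1")
  case True
  show thesis
    using face_inner_point[of "{i}" "{}"] upper_single lower_empty that
    by (auto simp: face_single True)
next
  case False
  then have s: "s = -1" using assms by auto
  then have "lower {i}"
    using assms(2) face_nonempty_iff[of "{}" "{i}"] by (simp add: face_single)
  then show thesis
    using face_inner_point[of "{}" "{i}"] upper_empty that by (auto simp: face_single s)
qed

text \<open>An inner point of a side has a single coordinate at its bound, which recovers the index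
  and then the sign. Empty sides would coincide, hence the nonemptiness hypothesis.\<close>

lemma side_inject:
  assumes "s \<in> {1, -1}" "t \<in> {1, -1}" "side i s = side j t" "side i s \<noteq> {}"
  shows "i = j \<and> s = t"
proof -
  obtain w where w: "w \<in> side i s" "\<And>j. j \<noteq> i \<Longrightarrow> \<bar>w $ j\<bar> < a j"
    using side_inner_point assms by blast
  have wj: "w $ j = t * a j" "w $ i = s * a i" using w(1) assms(3) by (auto simp: side_def)
  then have "\<bar>w $ j\<bar> = a j" using assms(2) a_pos[of j] by auto
  then have "i = j" using w(2)[of j] by auto
  then show ?thesis using wj a_pos[of j] by auto
qed

section \<open>Dimension and facets of the section\<close>

abbreviation plane :: "(real ^ 'n) set" where
  "plane \<equiv> {w. (\<chi> i. 1) \<bullet> w = c}"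

lemma inner_one: "(\<chi> i. 1) \<bullet> w = (\<Sum>i\<in>UNIV. w $ i)" for w :: "real ^ 'n"
  by (simp add: inner_vec_def)

lemma plane_iff: "w \<in> plane \<longleftrightarrow> (\<Sum>i\<in>UNIV. w $ i) = c"
  by (simp add: inner_one)

lemma aff_dim_plane: "aff_dim plane = int CARD('n) - 1"
proof -
  have "(\<chi> i. 1) \<noteq> (0 :: real ^ 'n)" by (simp add: vec_eq_iff)
  then show ?thesis by (simp add: aff_dim_hyperplane)
qed

lemma open_inner: "open {w :: real ^ 'n. \<forall>j. j \<in> J \<longrightarrow> \<bar>w $ j\<bar> < a j}"
proof -
  have "open (\<Inter>j\<in>J. {w :: real ^ 'n. \<bar>w $ j\<bar> < a j})"
    by (intro open_INT open_Collect_less ballI continuous_intros) auto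
  also have "(\<Inter>j\<in>J. {w :: real ^ 'n. \<bar>w $ j\<bar> < a j}) = {w. \<forall>j. j \<in> J \<longrightarrow> \<bar>w $ j\<bar> < a j}"
    by auto
  finally show ?thesis .
qed

text \<open>The plane meets the open box, and a nonempty relatively open piece of an affine set has
  the same affine hull. So \<open>slice\<close> is caught between two sets of the dimension of the
  plane.\<close>

lemma aff_dim_slice: "aff_dim slice = int CARD('n) - 1"
proof -
  let ?O = "{w :: real ^ 'n. \<forall>j. j \<in> UNIV \<longrightarrow> \<bar>w $ j\<bar> < a j}"
  obtain x where x: "x \<in> slice" "\<And>i. \<bar>x $ i\<bar> < a i" using inner_point by blast
  then have "plane \<inter> ?O \<noteq> {}" using plane_iff slice_iff by auto
  then have "affine hull (plane \<inter> ?O) = affine hull plane"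
    by (intro affine_hull_affine_Int_open affine_hyperplane open_inner)
  then have "aff_dim (affine hull (plane \<inter> ?O)) = aff_dim (affine hull plane)"
    by (rule arg_cong)
  then have "aff_dim (plane \<inter> ?O) = aff_dim plane" by (simp only: aff_dim_affine_hull)
  moreover have "aff_dim (plane \<inter> ?O) \<le> aff_dim slice"
  proof (intro aff_dim_subset subsetI)
    fix w assume w: "w \<in> plane \<inter> ?O"
    then have "(\<Sum>i\<in>UNIV. w $ i) = c" using plane_iff by blast
    then show "w \<in> slice" using w by (simp add: slice_iff less_imp_le)
  qed
  moreover have "aff_dim slice \<le> aff_dim plane"
    by (rule aff_dim_subset) (auto simp: slice_iff inner_one)
  ultimately show ?thesis using aff_dim_plane by simp
qed

lemma convex_slice: "convex slice"
proof -
  have "slice = cbox (\<chi> i. - a i) (\<chi> i. a i) \<inter> plane"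
    by (auto simp: slice_def inner_one)
  then show ?thesis by (simp add: convex_Int convex_hyperplane)
qed

lemma polytope_slice: "polytope slice"
proof -
  have "slice = cbox (\<chi> i. - a i) (\<chi> i. a i) \<inter> plane"
    by (auto simp: slice_def inner_one)
  then show ?thesis
    by (simp add: polytope_Int_polyhedron polytope_interval polyhedron_hyperplane)
qed

lemma side_face_of:
  assumes "s \<in> {1, -1}"
  shows "side i s face_of slice"
proof -
  have "slice \<inter> {w. (s *\<^sub>R axis i 1) \<bullet> w = a i} face_of slice"
    using assms
    by (intro face_of_Int_supporting_hyperplane_le convex_slice)
      (auto simp: slice_iff inner_axis' abs_le_iff)
  also have "slice \<inter> {w. (s *\<^sub>R axis i 1) \<bullet> w = a i} = side i s"
    using assms by (auto simp: side_def inner_axis')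
  finally show ?thesis .
qed

text \<open>The same enclosure works one dimension lower: an inner point of \<open>slice\<close>
  lies in the plane but off \<open>?K\<close>, so cutting with \<open>?K\<close> lowers the
  dimension by exactly one.\<close>

lemma side_facet_of:
  assumes s: "s \<in> {1, -1}" and ne: "side i s \<noteq> {}"
  shows "side i s facet_of slice"
proof -
  let ?K = "{w. axis i 1 \<bullet> w = s * a i}"
  let ?O = "{w :: real ^ 'n. \<forall>j. j \<in> - {i} \<longrightarrow> \<bar>w $ j\<bar> < a j}"
  obtain w where w: "w \<in> side i s" "\<And>j. j \<noteq> i \<Longrightarrow> \<bar>w $ j\<bar> < a j"
    using side_inner_point assms by blast
  have wK: "w \<in> plane \<inter> ?K \<inter> ?O"
    using w by (simp add: side_def slice_iff inner_axis' inner_one)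
  obtain x where x: "x \<in> slice" "\<And>i. \<bar>x $ i\<bar> < a i" using inner_point by blast
  have "x \<in> plane" using x plane_iff slice_iff by auto
  moreover have "x \<notin> ?K" using x(2)[of i] s by (auto simp: inner_axis')
  ultimately have "\<not> plane \<subseteq> ?K" by auto
  moreover have "plane \<inter> ?K \<noteq> {}" using wK by blast
  ultimately have "aff_dim (plane \<inter> ?K) = aff_dim plane - 1"
    using aff_dim_affine_Int_hyperplane[OF affine_hyperplane, of "\<chi> i. 1" c "axis i 1" "s * a i"]
    by (simp split: if_splits)
  moreover have "affine hull (plane \<inter> ?K \<inter> ?O) = affine hull (plane \<inter> ?K)"
    using wK by (intro affine_hull_affine_Int_open affine_Int affine_hyperplane open_inner) auto
  then have "aff_dim (affine hull (plane \<inter> ?K \<inter> ?O)) = aff_dim (affine hull (plane \<inter> ?K))"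
    by (rule arg_cong)
  then have "aff_dim (plane \<inter> ?K \<inter> ?O) = aff_dim (plane \<inter> ?K)"
    by (simp only: aff_dim_affine_hull)
  moreover have "aff_dim (plane \<inter> ?K \<inter> ?O) \<le> aff_dim (side i s)"
  proof (intro aff_dim_subset subsetI)
    fix w assume w: "w \<in> plane \<inter> ?K \<inter> ?O"
    have "w $ i = s * a i" using w by (simp add: inner_axis')
    moreover from this have "\<bar>w $ i\<bar> \<le> a i" using s a_pos[of i] by auto
    then have "\<bar>w $ j\<bar> \<le> a j" for j using w by (cases "j = i") (auto simp: less_imp_le)
    moreover have "(\<Sum>i\<in>UNIV. w $ i) = c" using w plane_iff by blast
    ultimately show "w \<in> side i s" by (simp add: side_def slice_iff)
  qed
  moreover have "aff_dim (side i s) \<le> aff_dim (plane \<inter> ?K)"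
  proof (intro aff_dim_subset subsetI)
    fix w assume "w \<in> side i s"
    then show "w \<in> plane \<inter> ?K"
      by (simp add: side_def slice_iff inner_axis' inner_one)
  qed
  ultimately show ?thesis
    using side_face_of[OF s] ne aff_dim_plane aff_dim_slice by (simp add: facet_of_def)
qed

text \<open>A relative interior point of a facet has a tight coordinate, since otherwise it would be
  relatively interior in \<open>slice\<close> and the facet would be all of \<open>slice\<close>.
  The corresponding side is a face through that point, so it contains the facet, and equal
  dimensions give equality.\<close>

lemma facet_of_slice_iff:
  "F facet_of slice \<longleftrightarrow> (\<exists>i. \<exists>s\<in>{1, -1}. F = side i s \<and> side i s \<noteq> {})"
proof
  assume F: "F facet_of slice"
  then have face: "F face_of slice" and ne: "F \<noteq> {}" and dim: "aff_dim F = aff_dim slice - 1"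
    by (auto simp: facet_of_def)
  have "convex F" using face convex_slice face_of_imp_convex by blast
  then obtain x where x: "x \<in> rel_interior F"
    using ne rel_interior_eq_empty by blast
  have xF: "x \<in> F" using x rel_interior_subset by blast
  have xS: "x \<in> slice" using xF face face_of_imp_subset by blast
  have "\<exists>i. \<not> \<bar>x $ i\<bar> < a i"
  proof (rule ccontr)
    assume "\<not> ?thesis"
    then have inner: "\<And>i. \<bar>x $ i\<bar> < a i" by simp
    let ?O = "{w :: real ^ 'n. \<forall>j. j \<in> UNIV \<longrightarrow> \<bar>w $ j\<bar> < a j}"
    have sub: "affine hull slice \<subseteq> plane"
      by (intro hull_minimal affine_hyperplane subsetI) (simp add: inner_one slice_iff)
    have "x \<in> rel_interior slice"
      unfolding mem_rel_interior
    proof (intro exI conjI)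
      show "open ?O" by (rule open_inner)
      show "x \<in> ?O \<inter> slice" using inner xS by simp
      show "?O \<inter> affine hull slice \<subseteq> slice"
      proof
        fix w assume w: "w \<in> ?O \<inter> affine hull slice"
        then have "(\<Sum>i\<in>UNIV. w $ i) = c" using sub plane_iff by blast
        then show "w \<in> slice" using w by (auto simp: slice_iff less_imp_le)
      qed
    qed
    then have "slice \<subseteq> F"
      using subset_of_face_of[OF face order_refl] xF by blast
    then show False using face dim face_of_imp_subset by fastforce
  qed
  then obtain i where i: "\<not> \<bar>x $ i\<bar> < a i" by blast
  define s :: real where "s = (if x $ i > 0 then 1 else -1)"
  have s: "s \<in> {1, -1}" by (simp add: s_def)
  have "\<bar>x $ i\<bar> = a i" using i xS by (auto simp: slice_iff intro: antisym)
  then have xs: "x \<in> side i s"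
    using xS a_pos[of i] by (auto simp: side_def s_def abs_if split: if_splits)
  have "F \<subseteq> side i s"
    using subset_of_face_of[OF side_face_of[OF s], of F i] x xs face_of_imp_subset[OF face] by blast
  moreover have facet: "side i s facet_of slice"
    using side_facet_of[OF s] xs by blast
  then have "F face_of side i s"
    using face calculation face_of_subset facet_of_imp_subset by blast
  moreover have "aff_dim F = aff_dim (side i s)"
    using facet dim by (simp add: facet_of_def)
  moreover have "convex (side i s)"
    using facet convex_slice face_of_imp_convex facet_of_imp_face_of by blast
  ultimately have "F = side i s"
    using face_of_aff_dim_lt by (metis less_irrefl)
  then show "\<exists>i. \<exists>s\<in>{1, -1}. F = side i s \<and> side i s \<noteq> {}" using s ne by blast
next
  assume "\<exists>i. \<exists>s\<in>{1, -1}. F = side i s \<and> side i s \<noteq> {}"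
  then show "F facet_of slice" using side_facet_of by blast
qed

section \<open>Vertices and simplicity\<close>

lemma generic_coordinate:
  assumes "v \<in> slice"
  obtains i where "\<bar>v $ i\<bar> < a i"
proof -
  have False if *: "\<And>i. \<not> \<bar>v $ i\<bar> < a i"
  proof -
    define A where "A = {i. v $ i > 0}"
    have eq: "\<bar>v $ i\<bar> = a i" for i
      using *[of i] assms by (auto simp: slice_iff intro: antisym)
    have "v $ i = a i" if "i \<in> A" for i
      using eq[of i] that by (simp add: A_def)
    moreover have "v $ i = - a i" if "i \<in> - A" for i
      using eq[of i] that by (simp add: A_def abs_if split: if_splits)
    ultimately have "(\<Sum>i\<in>A. v $ i) = sum a A" "(\<Sum>i\<in>- A. v $ i) = - sum a (- A)"
      unfolding sum_negf[symmetric] by (simp_all cong: sum.cong del: Compl_iff)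
    then have "(\<Sum>i\<in>UNIV. v $ i) = sum a A - sum a (- A)"
      using sum_Compl[of "\<lambda>i. v $ i" A] by simp
    then show False using generic[of A] assms by (simp add: slice_iff)
  qed
  then show thesis using that by blast
qed

text \<open>With two free coordinates, raising one and lowering the other by the same small amount
  keeps the sum, so the point would be the midpoint of a segment in \<open>slice\<close>.\<close>

lemma extreme_point_inner_unique:
  assumes v: "v extreme_point_of slice" and "\<bar>v $ i\<bar> < a i" "\<bar>v $ j\<bar> < a j"
  shows "i = j"
proof (rule ccontr)
  assume ij: "i \<noteq> j"
  define t where "t = min (a i - \<bar>v $ i\<bar>) (a j - \<bar>v $ j\<bar>)"
  define d :: "real ^ 'n" where "d = axis i t - axis j t"
  have t: "t > 0" "\<bar>v $ i\<bar> + t \<le> a i" "\<bar>v $ j\<bar> + t \<le> a j"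
    using assms by (auto simp: t_def)
  have d: "d $ k = (if k = i then t else if k = j then - t else 0)" for k
    using ij by (auto simp: d_def axis_def)
  have "(\<Sum>k\<in>UNIV. d $ k) = 0"
    by (simp add: d_def axis_def sum_subtractf)
  moreover have vS: "v \<in> slice" using v by (simp add: extreme_point_of_def)
  ultimately have "v + d \<in> slice" "v - d \<in> slice"
    using t by (auto simp: slice_iff d sum.distrib sum_subtractf)
  moreover have "(v + d) $ i \<noteq> (v - d) $ i" using d[of i] t by simp
  then have "v + d \<noteq> v - d" by metis
  moreover have "v = midpoint (v + d) (v - d)"
    by (simp add: midpoint_def vec_eq_iff)
  ultimately have "v \<in> open_segment (v + d) (v - d)"
    by (metis midpoint_in_open_segment)
  then show False
    using v \<open>v + d \<in> slice\<close> \<open>v - d \<in> slice\<close> by (auto simp: extreme_point_of_def)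
qed

text \<open>Exactly one coordinate of a vertex is free, by the two preceding lemmas. Each other
  coordinate contributes the one facet selected by its sign, which makes \<open>CARD('n) - 1\<close>
  facets.\<close>

lemma simple_polytope_slice: "simple_polytope slice"
  unfolding simple_polytope_def
proof (intro conjI allI impI polytope_slice)
  fix v assume v: "v extreme_point_of slice"
  then have vS: "v \<in> slice" by (simp add: extreme_point_of_def)
  obtain k where k: "\<bar>v $ k\<bar> < a k" using generic_coordinate[OF vS] by blast
  have tight: "\<bar>v $ i\<bar> = a i" if "i \<noteq> k" for i
    using extreme_point_inner_unique[OF v k, of i] that vS
    by (metis slice_iff order_less_le)
  define g where "g = (\<lambda>i. side i (sgn (v $ i)))"
  have sgn: "sgn (v $ i) \<in> {1, -1}" "v \<in> g i" if "i \<noteq> k" for i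
  proof -
    show "sgn (v $ i) \<in> {1, -1}" using tight[OF that] a_pos[of i] by (auto simp: sgn_if)
    show "v \<in> g i" using tight[OF that] vS sgn_mult_abs[of "v $ i"] by (auto simp: g_def side_def)
  qed
  have "{F. F facet_of slice \<and> v \<in> F} = g ` (- {k})"
  proof (intro equalityI subsetI)
    fix F assume "F \<in> {F. F facet_of slice \<and> v \<in> F}"
    then obtain i s where F: "F = side i s" "s \<in> {1, -1}" "v \<in> side i s"
      by (auto simp: facet_of_slice_iff)
    then have vi: "v $ i = s * a i" by (simp add: side_def)
    then have "i \<noteq> k" using k F(2) by auto
    moreover have "sgn (v $ i) = s" using vi F(2) a_pos[of i] by (auto simp: sgn_mult)
    ultimately show "F \<in> g ` (- {k})" using F by (auto simp: g_def)
  next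
    fix F assume "F \<in> g ` (- {k})"
    then show "F \<in> {F. F facet_of slice \<and> v \<in> F}"
    proof -
      obtain i where i: "i \<noteq> k" "F = g i" using \<open>F \<in> g ` (- {k})\<close> by blast
      then have "F facet_of slice"
        using sgn[OF i(1)] side_facet_of[of "sgn (v $ i)" i] by (auto simp: g_def)
      then show ?thesis using sgn(2) i by blast
    qed
  qed
  moreover have "inj_on g (- {k})"
  proof (rule inj_onI)
    fix i j assume "i \<in> - {k}" "j \<in> - {k}" "g i = g j"
    then show "i = j"
      using side_inject[OF sgn(1) sgn(1), of i j] sgn(2)[of i] by (auto simp: g_def)
  qed
  ultimately have "card {F. F facet_of slice \<and> v \<in> F} = card (- {k})"
    by (simp add: card_image)
  then show "int (card {F. F facet_of slice \<and> v \<in> F}) = aff_dim slice"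
    by (simp add: aff_dim_slice card_Diff_singleton Compl_eq_Diff_UNIV of_nat_diff Suc_leI)
qed

text \<open>By \<open>face_nonempty_iff\<close>, the facets at the upper bounds for \<open>A\<close>
  and at the lower bounds for \<open>B\<close> have a common point iff \<open>A\<close> and
  \<open>B\<close> are disjoint, \<open>upper A\<close> and \<open>lower B\<close>. Disjointness is
  itself a condition on pairs, so the flag property splits into one statement on
  \<open>upper\<close> and one on \<open>lower\<close>.\<close>

lemma flagtope_slice_iff:
  "flagtope slice \<longleftrightarrow>
     (\<forall>A. (\<forall>x\<in>A. \<forall>y\<in>A. upper {x, y}) \<longrightarrow> upper A) \<and>
     (\<forall>B. (\<forall>x\<in>B. \<forall>y\<in>B. lower {x, y}) \<longrightarrow> lower B)"
proof (intro iffI conjI allI impI)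
  assume flag: "flagtope slice"
  have flagD: "\<Inter>C \<noteq> {}"
    if "C \<subseteq> {F. F facet_of slice}" "\<And>F G. F \<in> C \<Longrightarrow> G \<in> C \<Longrightarrow> F \<inter> G \<noteq> {}" for C
    using flag[unfolded flagtope_def, THEN conjunct2, THEN spec, of C] that by simp
  { fix A assume A: "\<forall>x\<in>A. \<forall>y\<in>A. upper {x, y}"
    let ?C = "(\<lambda>i. face {i} {}) ` A"
    have "?C \<subseteq> {F. F facet_of slice}"
      using face_nonempty_iff[of "{_}" "{}"] upper_single lower_empty
      by (auto simp: facet_of_slice_iff face_single)
    moreover have "face {x} {} \<inter> face {y} {} \<noteq> {}" if "x \<in> A" "y \<in> A" for x y
    proof -
      have "face {x} {} \<inter> face {y} {} = face {x, y} {}" by (auto simp: face_def)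
      then show ?thesis using A that lower_empty face_nonempty_iff by auto
    qed
    ultimately have "\<Inter>?C \<noteq> {}"
      by (intro flagD) auto
    then obtain w where w: "w \<in> \<Inter>?C" by blast
    \<comment> \<open>The empty collection has intersection \<open>UNIV\<close>, which yields no
      point of \<open>slice\<close>, so \<open>A = {}\<close> is treated apart.\<close>
    show "upper A"
    proof (cases "A = {}")
      case True then show ?thesis using upper_empty by simp
    next
      case False
      then have "w \<in> face A {}" using w by (auto simp: face_def)
      then show ?thesis by (rule face_nonemptyD)
    qed }
  { fix B assume B: "\<forall>x\<in>B. \<forall>y\<in>B. lower {x, y}"
    let ?C = "(\<lambda>i. face {} {i}) ` B"
    \<comment> \<open>The diagonal pair makes the side nonempty and so a facet; at upper bounds
      \<open>upper_single\<close> ensures this.\<close>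
    have "lower {x}" if "x \<in> B" for x using B that by fastforce
    then have "?C \<subseteq> {F. F facet_of slice}"
      using face_nonempty_iff[of "{}" "{_}"] upper_empty
      by (auto simp: facet_of_slice_iff face_single)
    moreover have "face {} {x} \<inter> face {} {y} \<noteq> {}" if "x \<in> B" "y \<in> B" for x y
    proof -
      have "face {} {x} \<inter> face {} {y} = face {} {x, y}" by (auto simp: face_def)
      then show ?thesis using B that upper_empty face_nonempty_iff by auto
    qed
    ultimately have "\<Inter>?C \<noteq> {}"
      by (intro flagD) auto
    then obtain w where w: "w \<in> \<Inter>?C" by blast
    show "lower B"
    proof (cases "B = {}")
      case True then show ?thesis using lower_empty by simp
    next
      case False
      then have "w \<in> face {} B" using w by (auto simp: face_def)
      then show ?thesis by (rule face_nonemptyD)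
    qed }
next
  assume R: "(\<forall>A. (\<forall>x\<in>A. \<forall>y\<in>A. upper {x, y}) \<longrightarrow> upper A) \<and>
     (\<forall>B. (\<forall>x\<in>B. \<forall>y\<in>B. lower {x, y}) \<longrightarrow> lower B)"
  have up: "upper A" if "\<forall>x\<in>A. \<forall>y\<in>A. upper {x, y}" for A
    using R[THEN conjunct1, THEN spec, of A] that by (rule mp)
  have low: "lower B" if "\<forall>x\<in>B. \<forall>y\<in>B. lower {x, y}" for B
    using R[THEN conjunct2, THEN spec, of B] that by (rule mp)
  show "flagtope slice"
    unfolding flagtope_def
  proof (intro conjI allI impI simple_polytope_slice, elim conjE)
    fix C assume C: "C \<subseteq> {F. F facet_of slice}" and int: "\<forall>F\<in>C. \<forall>G\<in>C. F \<inter> G \<noteq> {}"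
    define A where "A = {i. face {i} {} \<in> C}"
    define B where "B = {i. face {} {i} \<in> C}"
    have "upper A"
    proof (rule up, intro ballI)
      fix x y assume "x \<in> A" "y \<in> A"
      then have "face {x} {} \<inter> face {y} {} \<noteq> {}" using int by (auto simp: A_def)
      also have "face {x} {} \<inter> face {y} {} = face {x, y} {}" by (auto simp: face_def)
      finally show "upper {x, y}" using face_nonempty_iff by simp
    qed
    moreover have "lower B"
    proof (rule low, intro ballI)
      fix x y assume "x \<in> B" "y \<in> B"
      then have "face {} {x} \<inter> face {} {y} \<noteq> {}" using int by (auto simp: B_def)
      also have "face {} {x} \<inter> face {} {y} = face {} {x, y}" by (auto simp: face_def)
      finally show "lower {x, y}" using face_nonempty_iff by simp
    qed
    moreover have "A \<inter> B = {}"
    proof (rule ccontr)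
      assume "A \<inter> B \<noteq> {}"
      then obtain i where "face {i} {} \<in> C" "face {} {i} \<in> C"
        by (auto simp: A_def B_def)
      then have "face {i} {} \<inter> face {} {i} \<noteq> {}" using int by blast
      moreover have "face {i} {} \<inter> face {} {i} = face {i} {i}" by (auto simp: face_def)
      ultimately show False using face_nonempty_iff[of "{i}" "{i}"] by simp
    qed
    ultimately have "face A B \<noteq> {}" using face_nonempty_iff by simp
    then obtain w where w: "w \<in> face A B" by blast
    have "w \<in> F" if F: "F \<in> C" for F
    proof -
      have "F facet_of slice" using C F by blast
      then obtain i s where "F = side i s" "s \<in> {1, -1}"
        unfolding facet_of_slice_iff by blast
      then have "F = face {i} {} \<or> F = face {} {i}" by (auto simp: face_single)
      then show ?thesis
      proof
        assume F': "F = face {i} {}"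
        then have "i \<in> A" using F by (simp add: A_def)
        then show "w \<in> F" using w F' by (auto simp: face_def)
      next
        assume F': "F = face {} {i}"
        then have "i \<in> B" using F by (simp add: B_def)
        then show "w \<in> F" using w F' by (auto simp: face_def)
      qed
    qed
    then show "\<Inter>C \<noteq> {}" by blast
  qed
qed

end

section \<open>Transfer to the moment polytope along the coordinate numbering\<close>

theorem theorem5p2:
  fixes m :: nat and \<alpha> :: "nat \<Rightarrow> real" and e :: "'n::finite \<Rightarrow> nat"
  assumes coords: "bij_betw e (UNIV :: 'n set) {1..m - 1}"
    and "length_vector m \<alpha>"
    and "generic m \<alpha>"
    and "mono_on {1..m - 1} \<alpha>"
    and "\<alpha> m < (\<Sum>i=1..m - 1. \<alpha> i)"
    and "\<forall>i\<in>{1..m}. \<alpha> i < (\<Sum>j\<in>{1..m} - {i}. \<alpha> j)"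
  shows "flagtope (moment_polytope e m \<alpha>) \<longleftrightarrow>
      short_code m \<alpha> = {{1..m - 3} \<union> {m}} \<or>
      short_code m \<alpha> = {{1..m - 4} \<union> {m - 2, m}} \<or>
      short_code m \<alpha> = {{1..m - 4} \<union> {m - 1, m}}"
proof -
  \<comment> \<open>The index type is nonempty, so \<open>m \<ge> 2\<close>; for
    \<open>m = 2\<close> each of the two lengths would be smaller than the other.\<close>
  have m3: "m \<ge> 3"
  proof (rule ccontr)
    assume "\<not> m \<ge> 3"
    moreover have "{1..m - 1} \<noteq> {}"
      using bij_betw_imp_surj_on[OF coords] by (metis UNIV_not_empty image_is_empty)
    ultimately have m: "m = 2" by auto
    have "{1..m} - {1} = {2}" "{1..m} - {2} = {1}" using m by auto
    then have "\<alpha> 1 < \<alpha> 2" "\<alpha> 2 < \<alpha> 1"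
      using assms(6)[rule_format, of 1] assms(6)[rule_format, of 2] m by auto
    then show False by simp
  qed
  interpret S: side_lengths m \<alpha>
  proof
    show "0 < \<alpha> i" if "i \<in> {1..m}" for i
      using assms(2) that by (simp add: length_vector_def)
    show "\<alpha> i < (\<Sum>j\<in>{1..m} - {i}. \<alpha> j)" if "i \<in> {1..m}" for i
      using assms(6) that by blast
  qed (fact assms(3) assms(4) m3)+
  let ?a = "\<lambda>i. \<alpha> (e i)"
  have inj: "inj e" and range: "range e = {1..m - 1}"
    using coords by (auto simp: bij_betw_def)
  have sub: "e ` A \<subseteq> {1..m - 1}" for A using range by blast
  have sum_e: "sum ?a A = sum \<alpha> (e ` A)" for A
    using inj by (simp add: sum.reindex inj_on_subset)
  have Compl_e: "e ` (- A) = {1..m - 1} - e ` A" for A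
    using inj range image_set_diff[of e UNIV A] by (simp add: Compl_eq_Diff_UNIV)
  have m_notin: "m \<notin> {1..m - 1}" using m3 by simp
  have sum_m: "sum \<alpha> (insert m (e ` A)) = \<alpha> m + sum ?a A" for A
    unfolding sum_e by (rule sum.insert) (use sub[of A] m_notin in auto)
  have insert_m: "insert m {1..m - 1} = {1..m}" using m3 by auto
  have Diff_e: "{1..m} - e ` A = insert m (e ` (- A))" "{1..m} - insert m (e ` A) = e ` (- A)" for A
    using sub[of A] m_notin unfolding Compl_e insert_m[symmetric] by blast+
  have sub_m: "e ` A \<subseteq> {1..m}" "insert m (e ` A) \<subseteq> {1..m}" for A
    using sub[of A] insert_m by blast+
  have short_e: "short m \<alpha> (e ` A) \<longleftrightarrow> sum ?a A < \<alpha> m + sum ?a (- A)"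
    and short_insert_e: "short m \<alpha> (insert m (e ` A)) \<longleftrightarrow> \<alpha> m + sum ?a A < sum ?a (- A)" for A
    using sub_m[of A] unfolding short_def Diff_e sum_m sum_e[symmetric] by simp_all
  interpret P: generic_slice ?a "\<alpha> m"
  proof
    show "0 < ?a i" for i
      using S.pos[of "e i"] sub_m(1)[of "{i}"] by simp
    \<comment> \<open>Equality would leave neither the image of \<open>A\<close> nor its complement
      short.\<close>
    show "sum ?a A \<noteq> \<alpha> m + sum ?a (- A)" for A
      using S.short_Diff_iff[OF sub_m(1), of A] unfolding Diff_e short_e short_insert_e by auto
    show "0 < \<alpha> m" using S.pos[of m] m3 by simp
    show "\<alpha> m < sum ?a UNIV" using assms(5) sum_e[of UNIV] range by simp
    show "?a i < \<alpha> m + sum ?a (- {i})" for i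
      using short_e[of "{i}"] S.short_single[of "e i"] sub_m(1)[of "{i}"] by simp
  qed
  have upper: "P.upper A \<longleftrightarrow> short m \<alpha> (e ` A)"
    and lower: "P.lower A \<longleftrightarrow> short m \<alpha> (insert m (e ` A))" for A
    by (simp_all add: P.upper_def P.lower_def short_e short_insert_e)
  have all_e: "(\<forall>A\<subseteq>{1..m - 1}. Q A) \<longleftrightarrow> (\<forall>A. Q (e ` A))" for Q
  proof (intro iffI allI impI)
    fix A assume "\<forall>A. Q (e ` A)" "A \<subseteq> {1..m - 1}"
    moreover obtain B where "A = e ` B"
      using \<open>A \<subseteq> {1..m - 1}\<close> range by (metis subset_imageE)
    ultimately show "Q A" by simp
  qed (use sub in blast)
  have "moment_polytope e m \<alpha> = P.slice"
    by (simp add: moment_polytope_def P.slice_def)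
  then have "flagtope (moment_polytope e m \<alpha>) \<longleftrightarrow> flagtope P.slice" by (rule arg_cong)
  also have "\<dots> \<longleftrightarrow> S.flag_condition"
    unfolding P.flagtope_slice_iff S.flag_condition_def all_e upper lower by simp
  also have "\<dots> \<longleftrightarrow> short_code m \<alpha> = {{1..m - 3} \<union> {m}} \<or>
      short_code m \<alpha> = {{1..m - 4} \<union> {m - 2, m}} \<or>
      short_code m \<alpha> = {{1..m - 4} \<union> {m - 1, m}}"
    by (rule iffI[OF S.flag_condition_imp_code S.code_imp_flag_condition])
  finally show ?thesis .
qed

end
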